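(* Let $m$ be a positive integer with $\mu(m)\neq 0$ and let $k\in\mathds{N}$ with $1\leqslant k<\zeta(m)$. Then $$P_{m,k} := \left\{f \in \mathcal{A} \mid f(n) = 0 \text{ for all } n\in\mathds{N}^+ \text{ with } \zeta(\gcd(m, n)) \leqslant k \right\}$$ is not a prime ideal of $\mathcal{A}$.
   Context: $\mathds{N}$ denotes the non-negative integers and $\mathds{N}^+=\mathds{N}\setminus\{0\}$. $\mathcal{A}$ is the ring of arithmetical functions: the set of all functions $f\colon \mathds{N}^+\to\mathds{C}$ with pointwise addition $(f+g)(n)=f(n)+g(n)$ and Dirichlet convolution $(f*g)(n)=\sum_{ij=n}f(i)g(j)$ as multiplication. It is a commutative ring with identity $e$, where $e(1)=1$ and $e(n)=0$ for $n>1$. $\mu$ is the Möbius function, so $\mu(m)\neq0$ means $m$ is square-free. $\zeta(n)$ denotes the number of distinct prime divisors of $n$ (so $\zeta(1)=0$). *)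

theory Defs
  imports
    Complex_Main
    "HOL-Library.FuncSet"
    "HOL-Computational_Algebra.Primes"
    "HOL-Computational_Algebra.Squarefree"
    "HOL-Algebra.Ideal"
begin

text \<open>
  An arithmetical function lives on the positive integers. It is represented by an
  extensional function on \<^term>\<open>{0<..} :: nat set\<close>, so that equality in the carrier is
  equality at all positive arguments.
\<close>

definition dirichlet_conv :: "(nat \<Rightarrow> complex) \<Rightarrow> (nat \<Rightarrow> complex) \<Rightarrow> nat \<Rightarrow> complex" where
  "dirichlet_conv f g n = (\<Sum>(i, j) | i * j = n. f i * g j)"

definition arith_ring :: "(nat \<Rightarrow> complex) ring" where
  "arith_ring =
     \<lparr> carrier = {0<..} \<rightarrow>\<^sub>E UNIV,
       mult = (\<lambda>f g. restrict (dirichlet_conv f g) {0<..}),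
       one = restrict (\<lambda>n. if n = 1 then 1 else 0) {0<..},
       zero = restrict (\<lambda>n. 0) {0<..},
       add = (\<lambda>f g. restrict (\<lambda>n. f n + g n) {0<..}) \<rparr>"

definition num_prime_divisors :: "nat \<Rightarrow> nat" where
  "num_prime_divisors n = card (prime_factors n)"

definition moebius_mu :: "nat \<Rightarrow> int" where
  "moebius_mu n = (if squarefree n then (-1) ^ num_prime_divisors n else 0)"

definition P_set :: "nat \<Rightarrow> nat \<Rightarrow> (nat \<Rightarrow> complex) set" where
  "P_set m k = {f \<in> carrier arith_ring.
     \<forall>n > 0. num_prime_divisors (gcd m n) \<le> k \<longrightarrow> f n = 0}"

text \<open>
  The predicate \<^const>\<open>primeideal\<close> includes the ring axioms and the ideal property.
  The following two facts show that neither of them is what makes it fail for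
  \<^const>\<open>P_set\<close>.
\<close>

lemma finite_factor_pairs: "n > 0 \<Longrightarrow> finite {(i, j). i * j = (n::nat)}"
  by (rule finite_subset[of _ "{..n} \<times> {..n}"]) (auto intro: dvd_imp_le)

lemma dirichlet_conv_commute: "dirichlet_conv f g n = dirichlet_conv g f n"
  unfolding dirichlet_conv_def
  by (rule sum.reindex_bij_witness[of _ prod.swap prod.swap]) (auto simp: mult.commute)

lemma dirichlet_conv_cong:
  assumes "n > 0" "\<And>i. i > 0 \<Longrightarrow> f i = f' i" "\<And>i. i > 0 \<Longrightarrow> g i = g' i"
  shows "dirichlet_conv f g n = dirichlet_conv f' g' n"
  unfolding dirichlet_conv_def using assms by (intro sum.cong) auto

lemma dirichlet_conv_assoc:
  assumes n: "n > 0"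
  shows "dirichlet_conv (dirichlet_conv f g) h n = dirichlet_conv f (dirichlet_conv g h) n"
proof -
  have "dirichlet_conv (dirichlet_conv f g) h n =
          (\<Sum>p | fst p * snd p = n. \<Sum>q | fst q * snd q = fst p. f (fst q) * g (snd q) * h (snd p))"
    unfolding dirichlet_conv_def by (simp add: sum_distrib_right case_prod_unfold)
  also have "\<dots> = (\<Sum>(p, q) \<in> (SIGMA p : {p. fst p * snd p = n}. {q. fst q * snd q = fst p}).
          f (fst q) * g (snd q) * h (snd p))"
    by (rule sum.Sigma) (use n finite_factor_pairs in \<open>auto simp: case_prod_unfold\<close>)
  also have "\<dots> = (\<Sum>(p, q) \<in> (SIGMA p : {p. fst p * snd p = n}. {q. fst q * snd q = snd p}).
          f (fst p) * (g (fst q) * h (snd q)))"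
    by (rule sum.reindex_bij_witness[of _
          "\<lambda>((a, b), (c, d)). ((a * c, d), (a, c))" "\<lambda>((a, b), (c, d)). ((c, d * b), (d, b))"])
       (auto simp: mult_ac)
  also have "\<dots> =
          (\<Sum>p | fst p * snd p = n. \<Sum>q | fst q * snd q = snd p. f (fst p) * (g (fst q) * h (snd q)))"
    by (rule sum.Sigma[symmetric]) (use n finite_factor_pairs in \<open>auto simp: case_prod_unfold\<close>)
  also have "\<dots> = dirichlet_conv f (dirichlet_conv g h) n"
    unfolding dirichlet_conv_def by (simp add: sum_distrib_left case_prod_unfold)
  finally show ?thesis .
qed

lemma dirichlet_conv_one:
  assumes n: "n > 0"
  shows "dirichlet_conv (\<lambda>n. if n = 1 then 1 else 0) g n = g n"
proof -
  have "dirichlet_conv (\<lambda>n. if n = 1 then 1 else 0) g n =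
          (\<Sum>(i, j) \<in> {(1 :: nat, n)}. (if i = 1 then 1 else 0) * g j)"
    unfolding dirichlet_conv_def
    by (rule sum.mono_neutral_right) (use n finite_factor_pairs in \<open>auto split: if_splits\<close>)
  then show ?thesis by simp
qed

lemma dirichlet_conv_add_left:
  "dirichlet_conv (\<lambda>n. f n + g n) h n = dirichlet_conv f h n + dirichlet_conv g h n"
  unfolding dirichlet_conv_def by (simp add: case_prod_unfold ring_distribs sum.distrib)

lemma cring_arith_ring: "cring arith_ring"
proof (rule cringI)
  show "abelian_group arith_ring"
  proof (rule abelian_groupI)
    fix f assume "f \<in> carrier arith_ring"
    then show "\<exists>g \<in> carrier arith_ring. g \<oplus>\<^bsub>arith_ring\<^esub> f = \<zero>\<^bsub>arith_ring\<^esub>"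
      by (intro bexI[of _ "restrict (\<lambda>n. - f n) {0<..}"])
         (auto simp: arith_ring_def fun_eq_iff)
  qed (auto simp: arith_ring_def fun_eq_iff restrict_def PiE_def extensional_def)
  show "comm_monoid arith_ring"
  proof (rule comm_monoidI)
    fix f g h assume "f \<in> carrier arith_ring" "g \<in> carrier arith_ring" "h \<in> carrier arith_ring"
    show "f \<otimes>\<^bsub>arith_ring\<^esub> g \<otimes>\<^bsub>arith_ring\<^esub> h = f \<otimes>\<^bsub>arith_ring\<^esub> (g \<otimes>\<^bsub>arith_ring\<^esub> h)"
    proof (rule ext)
      fix n
      have "dirichlet_conv (restrict (dirichlet_conv f g) {0<..}) h n =
              dirichlet_conv f (restrict (dirichlet_conv g h) {0<..}) n" if "n > 0"
        using that dirichlet_conv_assoc[OF that, of f g h]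
          dirichlet_conv_cong[OF that, of "restrict (dirichlet_conv f g) {0<..}" "dirichlet_conv f g" h h]
          dirichlet_conv_cong[OF that, of f f "restrict (dirichlet_conv g h) {0<..}" "dirichlet_conv g h"]
        by simp
      then show "(f \<otimes>\<^bsub>arith_ring\<^esub> g \<otimes>\<^bsub>arith_ring\<^esub> h) n = (f \<otimes>\<^bsub>arith_ring\<^esub> (g \<otimes>\<^bsub>arith_ring\<^esub> h)) n"
        by (simp add: arith_ring_def restrict_def)
    qed
  next
    fix f assume f: "f \<in> carrier arith_ring"
    show "\<one>\<^bsub>arith_ring\<^esub> \<otimes>\<^bsub>arith_ring\<^esub> f = f"
    proof (rule ext)
      fix n
      have "dirichlet_conv (restrict (\<lambda>n. if n = 1 then 1 else 0) {0<..}) f n = f n" if "n > 0"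
        using dirichlet_conv_one[OF that, of f]
          dirichlet_conv_cong[OF that, of "restrict (\<lambda>n. if n = 1 then 1 else 0) {0<..}"
            "\<lambda>n. if n = 1 then 1 else 0" f f]
        by simp
      with f show "(\<one>\<^bsub>arith_ring\<^esub> \<otimes>\<^bsub>arith_ring\<^esub> f) n = f n"
        by (auto simp: arith_ring_def restrict_def PiE_def extensional_def)
    qed
  qed (auto simp: arith_ring_def dirichlet_conv_commute intro!: restrict_ext)
  fix f g h assume "f \<in> carrier arith_ring" "g \<in> carrier arith_ring" "h \<in> carrier arith_ring"
  show "(f \<oplus>\<^bsub>arith_ring\<^esub> g) \<otimes>\<^bsub>arith_ring\<^esub> h =
          f \<otimes>\<^bsub>arith_ring\<^esub> h \<oplus>\<^bsub>arith_ring\<^esub> g \<otimes>\<^bsub>arith_ring\<^esub> h"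
  proof (rule ext)
    fix n
    have "dirichlet_conv (restrict (\<lambda>n. f n + g n) {0<..}) h n =
            dirichlet_conv f h n + dirichlet_conv g h n" if "n > 0"
      using dirichlet_conv_add_left[of f g h n]
        dirichlet_conv_cong[OF that, of "restrict (\<lambda>n. f n + g n) {0<..}" "\<lambda>n. f n + g n" h h]
      by simp
    then show "((f \<oplus>\<^bsub>arith_ring\<^esub> g) \<otimes>\<^bsub>arith_ring\<^esub> h) n =
            (f \<otimes>\<^bsub>arith_ring\<^esub> h \<oplus>\<^bsub>arith_ring\<^esub> g \<otimes>\<^bsub>arith_ring\<^esub> h) n"
      by (simp add: arith_ring_def restrict_def)
  qed
qed

lemma num_prime_divisors_mono: "a dvd b \<Longrightarrow> b > 0 \<Longrightarrow> num_prime_divisors a \<le> num_prime_divisors b"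
  unfolding num_prime_divisors_def by (intro card_mono dvd_prime_factors) auto

lemma ideal_P_set: "ideal (P_set m k) arith_ring"
proof -
  interpret cring arith_ring by (rule cring_arith_ring)
  have mult: "x \<otimes>\<^bsub>arith_ring\<^esub> f \<in> P_set m k" if f: "f \<in> P_set m k" and x: "x \<in> carrier arith_ring" for f x
  proof -
    have "dirichlet_conv x f n = 0" if n: "n > 0" "num_prime_divisors (gcd m n) \<le> k" for n
      unfolding dirichlet_conv_def
    proof (rule sum.neutral, clarify)
      fix i j assume "n = i * j"
      with n have "j > 0" "num_prime_divisors (gcd m j) \<le> num_prime_divisors (gcd m n)"
        by (auto intro!: num_prime_divisors_mono)
      with n f have "f j = 0" unfolding P_set_def by auto
      then show "x i * f j = 0" by simp
    qed
    then show ?thesis using m_closed[OF x, of f] f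
      by (auto simp: P_set_def) (auto simp: arith_ring_def)
  qed
  have minus: "\<ominus>\<^bsub>arith_ring\<^esub> f = restrict (\<lambda>n. - f n) {0<..}" if "f \<in> carrier arith_ring" for f
    by (rule minus_equality)
       (use that in \<open>auto simp: arith_ring_def fun_eq_iff\<close>)
  have sub: "subgroup (P_set m k) (add_monoid arith_ring)"
  proof (rule add.subgroupI)
    have "\<zero>\<^bsub>arith_ring\<^esub> \<in> P_set m k"
      using zero_closed by (simp add: P_set_def) (simp add: arith_ring_def)
    then show "P_set m k \<noteq> {}" by blast
    show "P_set m k \<subseteq> carrier arith_ring"
      by (auto simp: P_set_def)
    fix f g assume "f \<in> P_set m k"
    then show "\<ominus>\<^bsub>arith_ring\<^esub> f \<in> P_set m k"
      using minus[of f] a_inv_closed[of f] by (auto simp: P_set_def)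
    assume "g \<in> P_set m k"
    with \<open>f \<in> P_set m k\<close> show "f \<oplus>\<^bsub>arith_ring\<^esub> g \<in> P_set m k"
      by (auto simp: P_set_def arith_ring_def)
  qed
  show ?thesis
  proof (rule idealI[OF ring_axioms sub])
    fix f x assume f: "f \<in> P_set m k" and x: "x \<in> carrier arith_ring"
    show "x \<otimes>\<^bsub>arith_ring\<^esub> f \<in> P_set m k" using mult[OF f x] .
    then show "f \<otimes>\<^bsub>arith_ring\<^esub> x \<in> P_set m k"
      using f x m_comm[of f x] by (simp add: P_set_def)
  qed
qed

end

theory Submission
  imports Defs
begin

text \<open>
  The indicator functions \<open>\<delta>\<^sub>a\<close> of single positive integers satisfy
  \<open>\<delta>\<^sub>a * \<delta>\<^sub>b = \<delta>\<^sub>a\<^sub>b\<close>, and \<open>\<delta>\<^sub>a\<close> belongs to \<open>P\<^bsub>m,k\<^esub>\<close> exactly when more than \<open>k\<close>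
  primes divide both \<open>m\<close> and \<open>a\<close>. Split a product of \<open>k + 1\<close> distinct primes dividing
  \<open>m\<close> into one prime \<open>p\<close> and the product \<open>b\<close> of the remaining \<open>k\<close>. Since \<open>1 \<le> k\<close>, neither
  factor has enough primes, whereas their product does, so \<open>\<delta>\<^sub>p\<close> and \<open>\<delta>\<^sub>b\<close> lie outside
  \<open>P\<^bsub>m,k\<^esub>\<close> and \<open>\<delta>\<^sub>p * \<delta>\<^sub>b\<close> lies inside.
\<close>

definition arith_delta :: "nat \<Rightarrow> nat \<Rightarrow> complex" where
  "arith_delta a = restrict (\<lambda>n. if n = a then 1 else 0) {0<..}"

lemma arith_delta_closed: "arith_delta a \<in> carrier arith_ring"
  by (simp add: arith_delta_def arith_ring_def)

lemma arith_delta_mult: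
  assumes "a > 0" "b > 0"
  shows "arith_delta a \<otimes>\<^bsub>arith_ring\<^esub> arith_delta b = arith_delta (a * b)"
proof -
  have "dirichlet_conv (arith_delta a) (arith_delta b) n = (if n = a * b then 1 else 0)"
    if n: "n > 0" for n
  proof -
    have "dirichlet_conv (arith_delta a) (arith_delta b) n =
        (\<Sum>q \<in> {(i, j). i * j = n}. if q = (a, b) then 1 else 0)"
      unfolding dirichlet_conv_def
      by (rule sum.cong) (use n in \<open>auto simp: arith_delta_def split: if_splits\<close>)
    also have "\<dots> = (if n = a * b then 1 else 0)"
      using finite_factor_pairs[OF n] by auto
    finally show ?thesis .
  qed
  then show ?thesis
    unfolding arith_ring_def by (auto simp: arith_delta_def[of "a * b"] intro!: restrict_ext)
qed

lemma arith_delta_in_P_set_iff: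
  assumes "a > 0"
  shows "arith_delta a \<in> P_set m k \<longleftrightarrow> k < num_prime_divisors (gcd m a)"
proof -
  have "arith_delta a n = 0 \<longleftrightarrow> n \<noteq> a" if "n > 0" for n
    using that by (simp add: arith_delta_def)
  then show ?thesis
    using assms by (simp add: P_set_def arith_delta_closed) (metis not_le)
qed

lemma num_prime_divisors_gcd_prod:
  assumes "m > 0" and A: "A \<subseteq> prime_factors m"
  shows "num_prime_divisors (gcd m (\<Prod>A)) = card A"
proof -
  have prime: "prime p" if "p \<in> A" for p
    using A that by auto
  have fin: "finite A"
    using A by (rule finite_subset) simp
  have "0 \<notin> A"
    using prime[of 0] by auto
  then have "\<Prod>A \<noteq> 0"
    using fin by auto
  have "prime_factors (\<Prod>A) = (\<Union>p\<in>A. prime_factors p)"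
    using fin \<open>0 \<notin> A\<close> by (subst prime_factors_prod) auto
  also have "\<dots> = (\<Union>p\<in>A. {p})"
    using prime by (intro SUP_cong) (auto simp: prime_prime_factors)
  finally have "prime_factors (\<Prod>A) = A"
    by simp
  then have "prime_factors (gcd m (\<Prod>A)) = A"
    using assms \<open>\<Prod>A \<noteq> 0\<close> by (auto simp: prime_factors_gcd)
  then show ?thesis
    by (simp add: num_prime_divisors_def)
qed

theorem corollary3p26:
  fixes m k :: nat
  assumes "m > 0"
    and "moebius_mu m \<noteq> 0"
    and "1 \<le> k" and "k < num_prime_divisors m"
  shows "\<not> primeideal (P_set m k) arith_ring"
proof
  assume prime_ideal: "primeideal (P_set m k) arith_ring"
  obtain T where T: "T \<subseteq> prime_factors m" "card T = Suc k"
    using assms(4) obtain_subset_with_card_n[of "Suc k" "prime_factors m"]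
    by (auto simp: num_prime_divisors_def)
  then obtain p B where p: "T = insert p B" "p \<notin> B" "card B = k"
    by (auto simp: card_Suc_eq)
  have "finite B"
    using T p by (auto intro: finite_subset[of B "prime_factors m"])
  have "p > 0"
    using T p by (auto intro!: prime_gt_0_nat)
  have "\<Prod>B > 0"
    using T p by (intro prod_pos) (auto intro!: prime_gt_0_nat)
  have delta_iff: "arith_delta (\<Prod>A) \<in> P_set m k \<longleftrightarrow> k < card A" if "A \<subseteq> T" for A
  proof -
    have "\<Prod>A > 0"
      using T that by (intro prod_pos) (auto intro!: prime_gt_0_nat)
    then show ?thesis
      using num_prime_divisors_gcd_prod[OF assms(1), of A] T that
      by (simp add: arith_delta_in_P_set_iff)
  qed
  have "arith_delta p \<otimes>\<^bsub>arith_ring\<^esub> arith_delta (\<Prod>B) = arith_delta (\<Prod>T)"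
    using p \<open>finite B\<close> \<open>p > 0\<close> \<open>\<Prod>B > 0\<close> by (simp add: arith_delta_mult)
  moreover have "arith_delta (\<Prod>T) \<in> P_set m k"
    using delta_iff[of T] T by simp
  ultimately have "arith_delta p \<in> P_set m k \<or> arith_delta (\<Prod>B) \<in> P_set m k"
    using primeideal.I_prime[OF prime_ideal, of "arith_delta p" "arith_delta (\<Prod>B)"]
    by (simp add: arith_delta_closed)
  then show False
    using delta_iff[of "{p}"] delta_iff[of B] p assms(3) by auto
qed

end
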